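(* Let $p\ge 1$, let $\lambda_0<\lambda_1$ be real numbers, let $S_1\in\mathcal M_p(\mathbb R)$, and let $\mu:=T_0\delta_{\lambda_0}+T_1\delta_{\lambda_1}$, where $$T_0=\frac{1}{\lambda_1-\lambda_0}(\lambda_1I_p-S_1),\qquad T_1=\frac{1}{\lambda_1-\lambda_0}(S_1-\lambda_0I_p).$$ The following statements are equivalent: (1) $\mu$ is a matrix measure; (2) $\lambda_0I_p\preceq S_1\preceq\lambda_1I_p$.
   Context: $\mathcal M_p(\mathbb R)$ is the algebra of real $p\times p$ matrices and $I_p$ the identity matrix. $A\preceq B$ (Loewner order) means $B-A$ is symmetric positive semidefinite. $\delta_\lambda$ is the Dirac measure at $\lambda$. A matrix measure is a map $\mu=(\mu_{ij})_{1\le i,j\le p}$ on the Borel sets of $\mathbb R$, with entries finite signed measures, such that $\mu(B)$ is symmetric positive semidefinite for every Borel set $B$. *)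

theory Defs
  imports "HOL-Analysis.Analysis" "HOL-Probability.Probability"
begin

definition pos_semidef :: "real ^ 'n ^ 'n \<Rightarrow> bool" where
  "pos_semidef A \<longleftrightarrow> transpose A = A \<and> (\<forall>x. 0 \<le> x \<bullet> (A *v x))"

text \<open>The Loewner relation is defined on all square matrices; only the difference has to be
  symmetric.\<close>

definition loewner_le :: "real ^ 'n ^ 'n \<Rightarrow> real ^ 'n ^ 'n \<Rightarrow> bool" (infix "\<preceq>\<^sub>L" 50) where
  "A \<preceq>\<^sub>L B \<longleftrightarrow> pos_semidef (B - A)"

text \<open>The library has no signed measures. A finite signed measure on the Borel sets is a
  real-valued countably additive set function; its values outside the Borel sets are irrelevant.\<close>

definition finite_signed_measure :: "(real set \<Rightarrow> real) \<Rightarrow> bool" where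
  "finite_signed_measure m \<longleftrightarrow> m {} = 0 \<and>
     (\<forall>B :: nat \<Rightarrow> real set. range B \<subseteq> sets borel \<longrightarrow> disjoint_family B \<longrightarrow>
        (\<lambda>k. m (B k)) sums m (\<Union>k. B k))"

definition matrix_measure :: "(real set \<Rightarrow> real ^ 'n ^ 'n) \<Rightarrow> bool" where
  "matrix_measure \<mu> \<longleftrightarrow>
     (\<forall>i j. finite_signed_measure (\<lambda>B. \<mu> B $ i $ j)) \<and>
     (\<forall>B \<in> sets borel. pos_semidef (\<mu> B))"

definition dirac :: "real \<Rightarrow> real measure" where
  "dirac x = return borel x"

end

theory Submission
  imports Defs
begin

text \<open>Since the two atoms are distinct, evaluating the measure on the singletons at
  \<open>l0\<close> and \<open>l1\<close> recovers \<open>T0\<close> and \<open>T1\<close>, so both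
  must be positive semidefinite. Conversely, each value is a combination of \<open>T0\<close> and
  \<open>T1\<close> with nonnegative coefficients, and positive semidefinite matrices form a convex
  cone. This is \<open>matrix_measure_two_diracs_iff\<close>. Up to the positive factor 1 / (l1 -
  l0), the two weights are exactly the differences in the two Loewner inequalities, and
  \<open>pos_semidef_scaleR_iff\<close> removes that factor.\<close>

lemma pos_semidef_add:
  assumes "pos_semidef A" and "pos_semidef B"
  shows "pos_semidef (A + B)"
  using assms
  by (simp add: pos_semidef_def transpose_def vec_eq_iff matrix_vector_mult_add_rdistrib
      inner_add_right)

lemma pos_semidef_scaleR:
  assumes "0 \<le> c" and "pos_semidef A"
  shows "pos_semidef (c *\<^sub>R A)"
  using assms
  by (simp add: pos_semidef_def transpose_def vec_eq_iff scaleR_matrix_vector_assoc [symmetric])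

lemma pos_semidef_scaleR_iff:
  assumes "0 < c"
  shows "pos_semidef (c *\<^sub>R A) \<longleftrightarrow> pos_semidef A"
proof
  assume "pos_semidef (c *\<^sub>R A)"
  then have "pos_semidef ((1 / c) *\<^sub>R c *\<^sub>R A)"
    by (rule pos_semidef_scaleR [rotated]) (use assms in simp)
  with assms show "pos_semidef A"
    by simp
qed (use assms in \<open>simp add: pos_semidef_scaleR\<close>)

lemma measure_dirac:
  assumes "B \<in> sets borel"
  shows "measure (dirac x) B = indicator B x"
  using assms by (simp add: dirac_def measure_return)

text \<open>Finiteness carries countable additivity over from extended nonnegative values to the
  real-valued \<open>measure\<close>.\<close>

lemma finite_signed_measure_measure:
  assumes "finite_measure M" and "sets M = sets borel"
  shows "finite_signed_measure (measure M)"
  using finite_measure.finite_measure_UNION [OF assms(1)] assms(2)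
  by (simp add: finite_signed_measure_def)

lemma finite_signed_measure_dirac: "finite_signed_measure (measure (dirac x))"
proof (rule finite_signed_measure_measure)
  show "finite_measure (dirac x)"
    unfolding dirac_def by (intro prob_space.finite_measure prob_space_return) simp
qed (simp add: dirac_def)

lemma finite_signed_measure_add:
  assumes "finite_signed_measure m" and "finite_signed_measure m'"
  shows "finite_signed_measure (\<lambda>B. m B + m' B)"
  using assms by (auto simp: finite_signed_measure_def intro: sums_add)

text \<open>The constant stands on the right because the entries of
  \<open>measure (dirac x) B *\<^sub>R S\<close> simplify to
  \<open>measure (dirac x) B * S $ i $ j\<close>.\<close>

lemma finite_signed_measure_mult_right:
  assumes "finite_signed_measure m"
  shows "finite_signed_measure (\<lambda>B. m B * c)"
  using assms by (auto simp: finite_signed_measure_def intro: sums_mult2)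

lemma matrix_measure_two_diracs_iff:
  assumes "x \<noteq> y"
  shows "matrix_measure (\<lambda>B. measure (dirac x) B *\<^sub>R S + measure (dirac y) B *\<^sub>R T) \<longleftrightarrow>
    pos_semidef S \<and> pos_semidef T" (is "matrix_measure ?\<mu> \<longleftrightarrow> _")
proof
  assume "matrix_measure ?\<mu>"
  \<comment> \<open>As \<open>x\<close> and \<open>y\<close> differ, each singleton carries only one
    atom, so these two values are \<open>S\<close> and \<open>T\<close>.\<close>
  then have "pos_semidef (?\<mu> {x})" and "pos_semidef (?\<mu> {y})"
    by (simp_all add: matrix_measure_def)
  with assms show "pos_semidef S \<and> pos_semidef T"
    by (simp add: measure_dirac)
next
  assume "pos_semidef S \<and> pos_semidef T"
  then show "matrix_measure ?\<mu>"
    by (simp add: matrix_measure_def pos_semidef_add pos_semidef_scaleR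
        finite_signed_measure_add finite_signed_measure_mult_right finite_signed_measure_dirac)
qed

theorem theorem4p8:
  fixes l0 l1 :: real
    and S1 T0 T1 :: "real ^ 'n ^ 'n"
    and \<mu> :: "real set \<Rightarrow> real ^ 'n ^ 'n"
  assumes "l0 < l1"
    and "T0 = (1 / (l1 - l0)) *\<^sub>R (l1 *\<^sub>R mat 1 - S1)"
    and "T1 = (1 / (l1 - l0)) *\<^sub>R (S1 - l0 *\<^sub>R mat 1)"
    and "\<mu> = (\<lambda>B. measure (dirac l0) B *\<^sub>R T0 + measure (dirac l1) B *\<^sub>R T1)"
  shows "matrix_measure \<mu> \<longleftrightarrow> l0 *\<^sub>R mat 1 \<preceq>\<^sub>L S1 \<and> S1 \<preceq>\<^sub>L l1 *\<^sub>R mat 1"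
proof -
  have "0 < 1 / (l1 - l0)"
    using assms(1) by simp
  \<comment> \<open>The weights cross over: the one at the lower atom encodes the upper bound on
    \<open>S1\<close>, and the one at the upper atom encodes the lower bound.\<close>
  then have "pos_semidef T0 \<longleftrightarrow> S1 \<preceq>\<^sub>L l1 *\<^sub>R mat 1" and "pos_semidef T1 \<longleftrightarrow> l0 *\<^sub>R mat 1 \<preceq>\<^sub>L S1"
    unfolding assms(2,3) loewner_le_def by (simp_all only: pos_semidef_scaleR_iff)
  moreover have "matrix_measure \<mu> \<longleftrightarrow> pos_semidef T0 \<and> pos_semidef T1"
    unfolding assms(4) using assms(1) by (intro matrix_measure_two_diracs_iff) simp
  ultimately show ?thesis
    by blast
qed

end
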